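(* Let $G$ be a finite simple graph, let $v$ be a leaf vertex of $G$ and let $uv$ be the corresponding leaf edge. For an integer $n\ge 2$, let $G_v^n$ be the clan graph of $G$ obtained by replacing $v$ by a complete graph $K_n$ with vertices $v_1,\ldots,v_n$. Then \[ Y_{G_v^n} = Y_{G-v} + (Y_{K_n}-1)\,Y_{G-\{u,v\}} + \sum_{\alpha}X_{G_v^n}^{\alpha}, \] where $\alpha$ ranges over all maps from $V(G_v^n)$ to $\mathbb{N}$ such that $\alpha(u)\ge 1$ and $\alpha(v_i)\ge 1$ for some $1\le i\le n$.
   Context: $\mathbb{N}=\{0,1,2,\ldots\}$. A leaf vertex is a vertex of degree $1$. The graph $G_v^n$ is obtained from $G$ by replacing $v$ by the complete graph $K_n$ on $v_1,\ldots,v_n$ while preserving adjacency: each $v_i$ is adjacent to every neighbor of $v$ in $G$ (that is, to $u$) and to all other $v_j$, and all other adjacencies are as in $G$. $G-v$ and $G-\{u,v\}$ denote the graphs obtained by deleting the indicated vertices. Let $\mathbf{x}=\{x_1,x_2,\ldots\}$ be indeterminates. For a finite simple graph $H$ and $\alpha:V(H)\to\mathbb{N}$, a multicoloring of $H$ of type $\alpha$ is a map $\kappa$ assigning to each vertex $w$ a finite set $\kappa(w)$ of positive integers with $|\kappa(w)|=\alpha(w)$; it is proper if $\kappa(w)\cap\kappa(w')=\emptyset$ for every edge $ww'$. Define $X_H^\alpha=\sum_\kappa x_1^{a_1}x_2^{a_2}\cdots$, summed over all proper multicolorings $\kappa$ of type $\alpha$, where $a_i$ is the number of vertices $w$ with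 $i\in\kappa(w)$. Define the formal power series $Y_H=\sum_{\alpha:V(H)\to\mathbb{N}}X_H^\alpha$ (for the graph with no vertices, $Y=1$). *)

theory Defs
  imports
    "HOL-Library.Poly_Mapping"
    "HOL-Library.FuncSet"
    "Graph_Theory.Graph_Theory"
begin

section \<open>Formal power series in arbitrarily many indeterminates\<close>

text \<open>A monomial is its finitely supported exponent vector of type \<open>'x \<Rightarrow>\<^sub>0 nat\<close>; a power series is
  an arbitrary assignment of coefficients to monomials.\<close>

typedef ('x, 'a) mfps = "UNIV :: (('x \<Rightarrow>\<^sub>0 nat) \<Rightarrow> 'a) set"
  morphisms mfps_coeff Abs_mfps ..

setup_lifting type_definition_mfps

lemma mfps_eqI: "(\<And>m. mfps_coeff f m = mfps_coeff g m) \<Longrightarrow> f = g"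
  by transfer auto

lemma finite_le_poly_mapping:
  fixes m :: "'x \<Rightarrow>\<^sub>0 nat"
  shows "finite {a. \<forall>i. Poly_Mapping.lookup a i \<le> Poly_Mapping.lookup m i}" (is "finite ?A")
proof -
  let ?K = "Poly_Mapping.keys m"
  have "inj_on (\<lambda>a. restrict (Poly_Mapping.lookup a) ?K) ?A"
  proof (rule inj_onI)
    fix a b assume A: "a \<in> ?A" "b \<in> ?A" and R: "restrict (Poly_Mapping.lookup a) ?K = restrict (Poly_Mapping.lookup b) ?K"
    show "a = b"
    proof (rule poly_mapping_eqI)
      fix i show "Poly_Mapping.lookup a i = Poly_Mapping.lookup b i"
      proof (cases "i \<in> ?K")
        case True
        then show ?thesis using fun_cong[OF R, of i] by simp
      next
        case False
        then have "Poly_Mapping.lookup m i = 0" by (simp add: in_keys_iff)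
        then show ?thesis using A by (metis (mono_tags, lifting) le_zero_eq mem_Collect_eq)
      qed
    qed
  qed
  moreover have "(\<lambda>a. restrict (Poly_Mapping.lookup a) ?K) ` ?A \<subseteq> (\<Pi>\<^sub>E i\<in>?K. {..Poly_Mapping.lookup m i})"
    by auto
  moreover have "finite (\<Pi>\<^sub>E i\<in>?K. {..Poly_Mapping.lookup m i})"
    by (intro finite_PiE) auto
  ultimately show ?thesis
    by (meson finite_imageD finite_subset)
qed

lemma finite_antidiagonal:
  fixes m :: "'x \<Rightarrow>\<^sub>0 nat"
  shows "finite {(a, b). a + b = m}"
proof (rule finite_subset)
  show "{(a, b). a + b = m} \<subseteq> {a. \<forall>i. Poly_Mapping.lookup a i \<le> Poly_Mapping.lookup m i} \<times> {a. \<forall>i. Poly_Mapping.lookup a i \<le> Poly_Mapping.lookup m i}"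
    by (auto simp: lookup_add)
qed (intro finite_cartesian_product finite_le_poly_mapping)

instantiation mfps :: (type, comm_ring_1) comm_ring_1
begin

lift_definition zero_mfps :: "('a, 'b) mfps" is "\<lambda>_. 0" .
lift_definition one_mfps :: "('a, 'b) mfps" is "\<lambda>m. if m = 0 then 1 else 0" .
lift_definition plus_mfps :: "('a, 'b) mfps \<Rightarrow> ('a, 'b) mfps \<Rightarrow> ('a, 'b) mfps"
  is "\<lambda>f g m. f m + g m" .
lift_definition minus_mfps :: "('a, 'b) mfps \<Rightarrow> ('a, 'b) mfps \<Rightarrow> ('a, 'b) mfps"
  is "\<lambda>f g m. f m - g m" .
lift_definition uminus_mfps :: "('a, 'b) mfps \<Rightarrow> ('a, 'b) mfps"
  is "\<lambda>f m. - f m" .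
lift_definition times_mfps :: "('a, 'b) mfps \<Rightarrow> ('a, 'b) mfps \<Rightarrow> ('a, 'b) mfps"
  is "\<lambda>f g m. \<Sum>(a, b) | a + b = m. f a * g b" .

instance
proof
  fix f g h :: "('a, 'b) mfps"
  note fin = finite_antidiagonal
  have fin': "finite {p :: ('a \<Rightarrow>\<^sub>0 nat) \<times> ('a \<Rightarrow>\<^sub>0 nat). fst p + snd p = m}" for m
    using fin[of m] by (simp add: case_prod_unfold)
  show "f * g = g * f"
  proof (transfer, rule ext)
    fix f g :: "('a \<Rightarrow>\<^sub>0 nat) \<Rightarrow> 'b" and m
    show "(\<Sum>(a, b) | a + b = m. f a * g b) = (\<Sum>(a, b) | a + b = m. g a * f b)"
      by (rule sum.reindex_bij_witness[of _ prod.swap prod.swap]) (auto simp: add.commute mult.commute)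
  qed
  show "f * g * h = f * (g * h)"
  proof (transfer, rule ext)
    fix f g h :: "('a \<Rightarrow>\<^sub>0 nat) \<Rightarrow> 'b" and m
    have "(\<Sum>(p, c) | p + c = m. (\<Sum>(a, b) | a + b = p. f a * g b) * h c)
        = (\<Sum>pc | fst pc + snd pc = m. \<Sum>ab | fst ab + snd ab = fst pc. f (fst ab) * g (snd ab) * h (snd pc))"
      by (simp add: case_prod_unfold sum_distrib_right)
    also have "\<dots> = (\<Sum>(pc, ab) \<in> (SIGMA pc:{pc. fst pc + snd pc = m}. {ab. fst ab + snd ab = fst pc}).
        f (fst ab) * g (snd ab) * h (snd pc))"
      by (rule sum.Sigma) (use fin' in \<open>auto\<close>)
    also have "\<dots> = (\<Sum>(aq, bc) \<in> (SIGMA aq:{aq. fst aq + snd aq = m}. {bc. fst bc + snd bc = snd aq}).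
        f (fst aq) * (g (fst bc) * h (snd bc)))"
      by (rule sum.reindex_bij_witness[of _
            "\<lambda>(aq, bc). ((fst aq + fst bc, snd bc), (fst aq, fst bc))"
            "\<lambda>(pc, ab). ((fst ab, snd ab + snd pc), (snd ab, snd pc))"])
         (auto simp: ac_simps)
    also have "\<dots> = (\<Sum>aq | fst aq + snd aq = m. \<Sum>bc | fst bc + snd bc = snd aq. f (fst aq) * (g (fst bc) * h (snd bc)))"
      by (rule sum.Sigma[symmetric]) (use fin' in \<open>auto\<close>)
    also have "\<dots> = (\<Sum>(a, q) | a + q = m. f a * (\<Sum>(b, c) | b + c = q. g b * h c))"
      by (simp add: case_prod_unfold sum_distrib_left)
    finally show "(\<Sum>(p, c) | p + c = m. (\<Sum>(a, b) | a + b = p. f a * g b) * h c)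
        = (\<Sum>(a, q) | a + q = m. f a * (\<Sum>(b, c) | b + c = q. g b * h c))" .
  qed
  show "1 * f = f"
  proof (transfer, rule ext)
    fix f :: "('a \<Rightarrow>\<^sub>0 nat) \<Rightarrow> 'b" and m
    have "(\<Sum>(a, b) | a + b = m. (if a = 0 then 1 else 0) * f b)
        = (\<Sum>(a, b) \<in> {(0 :: 'a \<Rightarrow>\<^sub>0 nat, m)}. (if a = 0 then 1 else 0) * f b)"
      by (rule sum.mono_neutral_right) (use fin in \<open>auto split: if_splits\<close>)
    then show "(\<Sum>(a, b) | a + b = m. (if a = 0 then 1 else 0) * f b) = f m"
      by simp
  qed
  show "(f + g) * h = f * h + g * h"
    by transfer (simp add: case_prod_beta distrib_right sum.distrib)
  show "(0 :: ('a, 'b) mfps) \<noteq> 1"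
    by transfer (auto dest: fun_cong[of _ _ 0])
qed (transfer; auto simp: fun_eq_iff)+

end

definition mfps_monom :: "('x \<Rightarrow>\<^sub>0 nat) \<Rightarrow> ('x, 'a::comm_ring_1) mfps" where
  "mfps_monom m = Abs_mfps (\<lambda>k. if k = m then 1 else 0)"

lemma mfps_coeff_monom: "mfps_coeff (mfps_monom m) k = (if k = m then 1 else 0)"
  by (simp add: mfps_monom_def Abs_mfps_inverse)

text \<open>Formal (possibly infinite) sums are taken coefficientwise. This is meaningful for locally
  finite families, i.e. when every monomial occurs in only finitely many members.\<close>

definition mfps_locally_finite :: "('i \<Rightarrow> ('x, 'a::comm_ring_1) mfps) \<Rightarrow> 'i set \<Rightarrow> bool" where
  "mfps_locally_finite f A \<longleftrightarrow> (\<forall>m. finite {a \<in> A. mfps_coeff (f a) m \<noteq> 0})"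

lift_definition mfps_sum :: "('i \<Rightarrow> ('x, 'a::comm_ring_1) mfps) \<Rightarrow> 'i set \<Rightarrow> ('x, 'a) mfps"
  is "\<lambda>f A m. \<Sum>a | a \<in> A \<and> f a m \<noteq> 0. f a m" .

lemma mfps_sum_finite: "finite A \<Longrightarrow> mfps_sum f A = sum f A"
proof (induction A rule: finite_induct)
  case empty
  show ?case by (rule mfps_eqI) (simp add: mfps_sum.rep_eq zero_mfps.rep_eq)
next
  case (insert x A)
  have *: "mfps_coeff (mfps_sum f B) m = (\<Sum>a\<in>B. mfps_coeff (f a) m)" if "finite B" for B m
    unfolding mfps_sum.rep_eq by (rule sum.mono_neutral_left) (use that in auto)
  show ?case
    using insert
    by (intro mfps_eqI) (simp add: * plus_mfps.rep_eq insert.IH[symmetric])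
qed


section \<open>Graphs\<close>

text \<open>Finite simple graphs are \<^locale>\<open>graph\<close>s: finite symmetric digraphs without loops and parallel
  arcs. An edge is a pair of opposite arcs, so the degree of a vertex is its out-degree.\<close>

definition leaf_vertex :: "('a, 'b) pre_digraph \<Rightarrow> 'a \<Rightarrow> bool" where
  "leaf_vertex G v \<longleftrightarrow> v \<in> verts G \<and> out_degree G v = 1"

definition delete_verts :: "('a, 'b) pre_digraph \<Rightarrow> 'a set \<Rightarrow> ('a, 'b) pre_digraph" where
  "delete_verts G S = G \<restriction> (verts G - S)"

definition complete_graph :: "nat \<Rightarrow> (nat, nat \<times> nat) pre_digraph" where
  "complete_graph n = with_proj \<lparr> pverts = {1..n}, parcs = {(i, j). i \<in> {1..n} \<and> j \<in> {1..n} \<and> i \<noteq> j} \<rparr>"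

lemma complete_digraph_complete_graph: "complete_digraph n (complete_graph n)"
  unfolding complete_graph_def complete_digraph_pair_def by auto

text \<open>Vertex \<open>w \<noteq> v\<close> of \<open>G\<close> becomes \<open>Inl w\<close>, and the clones \<open>v\<^sub>1, \<dots>, v\<^sub>n\<close> of \<open>v\<close> are
  \<open>Inr 1, \<dots>, Inr n\<close>.\<close>

definition clan_graph :: "('a, 'b) pre_digraph \<Rightarrow> 'a \<Rightarrow> nat \<Rightarrow> ('a + nat, ('a + nat) \<times> ('a + nat)) pre_digraph" where
  "clan_graph G v n = with_proj \<lparr>
     pverts = Inl ` (verts G - {v}) \<union> Inr ` {1..n},
     parcs = {(Inl a, Inl b) | a b. (a, b) \<in> arcs_ends G \<and> a \<noteq> v \<and> b \<noteq> v}
           \<union> {(Inl a, Inr i) | a i. (a, v) \<in> arcs_ends G \<and> i \<in> {1..n}}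
           \<union> {(Inr i, Inl b) | i b. (v, b) \<in> arcs_ends G \<and> i \<in> {1..n}}
           \<union> {(Inr i, Inr j) | i j. i \<in> {1..n} \<and> j \<in> {1..n} \<and> i \<noteq> j} \<rparr>"

lemma graph_clan_graph:
  assumes "graph G"
  shows "graph (clan_graph G v n)"
proof -
  interpret graph G by fact
  have wf: "a \<in> verts G" "b \<in> verts G" "a \<noteq> b" "(b, a) \<in> arcs_ends G" if "(a, b) \<in> arcs_ends G" for a b
    using that sym_arcs no_loops
    by (auto simp: arcs_ends_def arc_to_ends_def symmetric_def dest: symD)
  define P where "P = \<lparr>
     pverts = Inl ` (verts G - {v}) \<union> Inr ` {1..n},
     parcs = {(Inl a, Inl b) | a b. (a, b) \<in> arcs_ends G \<and> a \<noteq> v \<and> b \<noteq> v}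
           \<union> {(Inl a, Inr i) | a i. (a, v) \<in> arcs_ends G \<and> i \<in> {1..n}}
           \<union> {(Inr i, Inl b) | i b. (v, b) \<in> arcs_ends G \<and> i \<in> {1..n}}
           \<union> {(Inr i, Inr j) | i j. i \<in> {1..n} \<and> j \<in> {1..n} \<and> i \<noteq> j} \<rparr>"
  have fv: "finite (pverts P)"
    by (simp add: P_def)
  have sub: "parcs P \<subseteq> pverts P \<times> pverts P"
    using wf by (auto simp: P_def)
  have loop: "fst e \<noteq> snd e" if "e \<in> parcs P" for e
    using that wf by (auto simp: P_def)
  have sy: "sym (parcs P)"
    using wf(4) by (auto simp: P_def intro!: symI)
  have "pair_graph P"
    using fv sub loop sy finite_subset[OF sub]
    by unfold_locales (auto simp: symmetric_def)
  then have "graph (with_proj P)"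
    by (rule pair_graph.pair_graphD_graph)
  then show ?thesis
    by (simp add: clan_graph_def P_def)
qed


section \<open>Multicolorings and the series \<open>X\<close> and \<open>Y\<close>\<close>

text \<open>Maps out of the vertex set are extensional functions (\<open>\<rightarrow>\<^sub>E\<close>), so that each of them is counted
  exactly once.\<close>

definition proper_multicolorings :: "('a, 'b) pre_digraph \<Rightarrow> ('a \<Rightarrow> nat) \<Rightarrow> ('a \<Rightarrow> nat set) set" where
  "proper_multicolorings H \<alpha> =
     {\<kappa> \<in> verts H \<rightarrow>\<^sub>E {S. finite S \<and> S \<subseteq> {1..}}.
        (\<forall>w \<in> verts H. card (\<kappa> w) = \<alpha> w) \<and>
        (\<forall>(w, w') \<in> arcs_ends H. \<kappa> w \<inter> \<kappa> w' = {})}"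

definition multicoloring_exponents :: "('a, 'b) pre_digraph \<Rightarrow> ('a \<Rightarrow> nat set) \<Rightarrow> (nat \<Rightarrow>\<^sub>0 nat)" where
  "multicoloring_exponents H \<kappa> = Abs_poly_mapping (\<lambda>i. card {w \<in> verts H. i \<in> \<kappa> w})"

text \<open>The indeterminate \<open>x\<^sub>0\<close> is available in the ambient ring but never occurs, since colors are
  positive.\<close>

definition X_series :: "('a, 'b) pre_digraph \<Rightarrow> ('a \<Rightarrow> nat) \<Rightarrow> (nat, int) mfps" where
  "X_series H \<alpha> = mfps_sum (\<lambda>\<kappa>. mfps_monom (multicoloring_exponents H \<kappa>)) (proper_multicolorings H \<alpha>)"

definition Y_series :: "('a, 'b) pre_digraph \<Rightarrow> (nat, int) mfps" where
  "Y_series H = mfps_sum (X_series H) (verts H \<rightarrow>\<^sub>E UNIV)"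

text \<open>The sums defining \<open>X\<close> and \<open>Y\<close> are locally finite.\<close>

lemma lookup_multicoloring_exponents:
  assumes "finite (verts H)" "\<kappa> \<in> proper_multicolorings H \<alpha>"
  shows "Poly_Mapping.lookup (multicoloring_exponents H \<kappa>) i = card {w \<in> verts H. i \<in> \<kappa> w}"
proof -
  have "{i. card {w \<in> verts H. i \<in> \<kappa> w} \<noteq> 0} \<subseteq> (\<Union>w\<in>verts H. \<kappa> w)"
    by (auto simp: card_eq_0_iff)
  moreover have "finite (\<Union>w\<in>verts H. \<kappa> w)"
    using assms by (auto simp: proper_multicolorings_def)
  ultimately have "finite {i. card {w \<in> verts H. i \<in> \<kappa> w} \<noteq> 0}"
    by (rule finite_subset)
  then show ?thesis
    by (simp add: multicoloring_exponents_def)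
qed

lemma finite_multicolorings_exponents:
  assumes fin: "finite (verts H)"
  shows "finite {\<kappa>. \<exists>\<alpha>. \<kappa> \<in> proper_multicolorings H \<alpha> \<and> multicoloring_exponents H \<kappa> = m}"
proof (rule finite_subset)
  show "{\<kappa>. \<exists>\<alpha>. \<kappa> \<in> proper_multicolorings H \<alpha> \<and> multicoloring_exponents H \<kappa> = m} \<subseteq> verts H \<rightarrow>\<^sub>E Pow (Poly_Mapping.keys m)"
  proof
    fix \<kappa>
    assume "\<kappa> \<in> {\<kappa>. \<exists>\<alpha>. \<kappa> \<in> proper_multicolorings H \<alpha> \<and> multicoloring_exponents H \<kappa> = m}"
    then obtain \<alpha> where \<kappa>: "\<kappa> \<in> proper_multicolorings H \<alpha>" and m: "m = multicoloring_exponents H \<kappa>"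
      by blast
    have "i \<in> Poly_Mapping.keys (multicoloring_exponents H \<kappa>)" if "w \<in> verts H" "i \<in> \<kappa> w" for w i
      using that fin \<kappa> by (auto simp: in_keys_iff lookup_multicoloring_exponents card_eq_0_iff)
    then show "\<kappa> \<in> verts H \<rightarrow>\<^sub>E Pow (Poly_Mapping.keys m)"
      using \<kappa> unfolding m by (auto simp: proper_multicolorings_def PiE_iff)
  qed
  show "finite (verts H \<rightarrow>\<^sub>E Pow (Poly_Mapping.keys m))"
    using fin by (intro finite_PiE) auto
qed

lemma X_series_locally_finite:
  assumes "finite (verts H)"
  shows "mfps_locally_finite
    (\<lambda>\<kappa>. mfps_monom (multicoloring_exponents H \<kappa>) :: (nat, int) mfps) (proper_multicolorings H \<alpha>)"
  unfolding mfps_locally_finite_def mfps_coeff_monom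
  by (auto intro: finite_subset[OF _ finite_multicolorings_exponents[OF assms]])

lemma Y_series_locally_finite:
  assumes fin: "finite (verts H)"
  shows "mfps_locally_finite (X_series H) (verts H \<rightarrow>\<^sub>E UNIV)"
  unfolding mfps_locally_finite_def
proof
  fix m
  let ?M = "{\<kappa>. \<exists>\<alpha>. \<kappa> \<in> proper_multicolorings H \<alpha> \<and> multicoloring_exponents H \<kappa> = m}"
  have "{\<alpha> \<in> verts H \<rightarrow>\<^sub>E UNIV. mfps_coeff (X_series H \<alpha>) m \<noteq> 0}
      \<subseteq> (\<lambda>\<kappa>. restrict (\<lambda>w. card (\<kappa> w)) (verts H)) ` ?M"
  proof
    fix \<alpha> assume "\<alpha> \<in> {\<alpha> \<in> verts H \<rightarrow>\<^sub>E UNIV. mfps_coeff (X_series H \<alpha>) m \<noteq> 0}"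
    then have \<alpha>: "\<alpha> \<in> verts H \<rightarrow>\<^sub>E UNIV" and nz: "mfps_coeff (X_series H \<alpha>) m \<noteq> 0"
      by auto
    have "\<exists>\<kappa>. \<kappa> \<in> proper_multicolorings H \<alpha> \<and> multicoloring_exponents H \<kappa> = m"
    proof (rule ccontr)
      assume "\<not> ?thesis"
      then have "mfps_coeff (X_series H \<alpha>) m = 0"
        unfolding X_series_def mfps_sum.rep_eq mfps_coeff_monom by (intro sum.neutral) auto
      with nz show False by simp
    qed
    then obtain \<kappa> where \<kappa>: "\<kappa> \<in> proper_multicolorings H \<alpha>" "multicoloring_exponents H \<kappa> = m"
      by blast
    moreover have "\<alpha> = restrict (\<lambda>w. card (\<kappa> w)) (verts H)"
      using \<alpha> \<kappa>(1) by (auto simp: proper_multicolorings_def fun_eq_iff PiE_iff extensional_def)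
    ultimately show "\<alpha> \<in> (\<lambda>\<kappa>. restrict (\<lambda>w. card (\<kappa> w)) (verts H)) ` ?M"
      by blast
  qed
  then show "finite {\<alpha> \<in> verts H \<rightarrow>\<^sub>E UNIV. mfps_coeff (X_series H \<alpha>) m \<noteq> 0}"
    by (rule finite_subset) (intro finite_imageI finite_multicolorings_exponents fin)
qed

end

theory Submission
  imports Defs
begin

text \<open>A series \<open>Y\<close> is the sum of the monomials of all proper multicolorings of the graph, whatever
  their type. Split the proper multicolorings of the clan graph according to whether they use no color
  on the clones \<open>v\<^sub>i\<close>, or some color on the clones but none on \<open>u\<close>, or colors on both. Uncolored
  vertices impose no constraint, so the first class is that of \<open>G - v\<close>. As \<open>u\<close> is the only
  neighbor of \<open>v\<close>, a member of the second class is an arbitrary pair of a nonempty multicoloring of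
  \<open>K\<^sub>n\<close> and a multicoloring of \<open>G - {u, v}\<close>.\<close>

section \<open>Locally finite sums\<close>

lemma mfps_locally_finite_subset:
  assumes "mfps_locally_finite f A" "B \<subseteq> A"
  shows "mfps_locally_finite f B"
  unfolding mfps_locally_finite_def
proof
  fix m
  show "finite {a \<in> B. mfps_coeff (f a) m \<noteq> 0}"
    by (rule finite_subset[of _ "{a \<in> A. mfps_coeff (f a) m \<noteq> 0}"])
       (use assms in \<open>auto simp: mfps_locally_finite_def\<close>)
qed

text \<open>The defining sum runs over the exact support, which varies with the family and the
  monomial. Padding it with zero terms lets several coefficients share one finite index set.\<close>

lemma mfps_coeff_sum_superset:
  assumes "finite S" "S \<subseteq> A" "{a \<in> A. mfps_coeff (f a) m \<noteq> 0} \<subseteq> S"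
  shows "mfps_coeff (mfps_sum f A) m = (\<Sum>a\<in>S. mfps_coeff (f a) m)"
  unfolding mfps_sum.rep_eq by (rule sum.mono_neutral_left) (use assms in auto)

text \<open>Local finiteness guards against the default value: a coefficient with infinite support
  is 0 by convention, which could break additivity.\<close>

lemma mfps_sum_union_disjoint:
  assumes "mfps_locally_finite f A" "mfps_locally_finite f B" "A \<inter> B = {}"
  shows "mfps_sum f (A \<union> B) = mfps_sum f A + mfps_sum f B"
proof (rule mfps_eqI)
  fix m
  have "{a \<in> A \<union> B. mfps_coeff (f a) m \<noteq> 0}
      = {a \<in> A. mfps_coeff (f a) m \<noteq> 0} \<union> {a \<in> B. mfps_coeff (f a) m \<noteq> 0}"
    by auto
  then show "mfps_coeff (mfps_sum f (A \<union> B)) m = mfps_coeff (mfps_sum f A + mfps_sum f B) m"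
    unfolding plus_mfps.rep_eq mfps_sum.rep_eq using assms
    by (auto simp: mfps_locally_finite_def intro!: sum.union_disjoint)
qed

text \<open>At each monomial the bijection matches the two supports. The equation is stated through
  \<open>i\<close>, since in the applications \<open>i\<close> extends a multicoloring and its
  monomial is easiest to compute there.\<close>

lemma mfps_sum_reindex_bij_witness:
  assumes "\<And>a. a \<in> A \<Longrightarrow> i (j a) = a" "\<And>a. a \<in> A \<Longrightarrow> j a \<in> B"
    and "\<And>b. b \<in> B \<Longrightarrow> j (i b) = b" "\<And>b. b \<in> B \<Longrightarrow> i b \<in> A"
    and eq: "\<And>b. b \<in> B \<Longrightarrow> f (i b) = g b"
  shows "mfps_sum f A = mfps_sum g B"
proof (rule mfps_eqI)
  fix m
  have eq': "f a = g (j a)" if "a \<in> A" for a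
    using assms that by metis
  show "mfps_coeff (mfps_sum f A) m = mfps_coeff (mfps_sum g B) m"
    unfolding mfps_sum.rep_eq
    by (rule sum.reindex_bij_witness[of _ i j]) (use assms eq' in auto)
qed

text \<open>For a fixed monomial only finitely many elements of the union contribute, and by
  disjointness they lie in finitely many blocks; what remains is a finite double sum. This flattens
  a sum of the series \<open>X_series H \<alpha>\<close> into one sum over multicolorings.\<close>

lemma mfps_sum_UN_disjoint:
  assumes fin: "mfps_locally_finite f (\<Union>i\<in>I. A i)"
    and disj: "disjoint_family_on A I"
  shows "mfps_sum (\<lambda>i. mfps_sum f (A i)) I = mfps_sum f (\<Union>i\<in>I. A i)"
proof (rule mfps_eqI)
  fix m
  define S where "S = {a \<in> (\<Union>i\<in>I. A i). mfps_coeff (f a) m \<noteq> 0}"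
  have finS: "finite S"
    using fin unfolding mfps_locally_finite_def S_def by blast
  define J where "J = {i \<in> I. A i \<inter> S \<noteq> {}}"
  have finJ: "finite J"
  \<comment> \<open>Choosing a contributing element from each block of \<open>J\<close> gives an
    injection into the finite set \<open>S\<close>, because disjoint blocks cannot share a
    representative.\<close>
  proof (rule inj_on_finite)
    have "\<exists>a. a \<in> A i \<inter> S" if "i \<in> J" for i
      using that by (auto simp: J_def)
    then have pick: "(SOME a. a \<in> A i \<inter> S) \<in> A i \<inter> S" if "i \<in> J" for i
      using that by (metis (mono_tags, lifting) someI_ex)
    then show "(\<lambda>i. SOME a. a \<in> A i \<inter> S) ` J \<subseteq> S"
      by blast
    show "inj_on (\<lambda>i. SOME a. a \<in> A i \<inter> S) J"
    proof (rule inj_onI)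
      fix i j
      assume ij: "i \<in> J" "j \<in> J" "(SOME a. a \<in> A i \<inter> S) = (SOME a. a \<in> A j \<inter> S)"
      with pick[of i] pick[of j] have "A i \<inter> A j \<noteq> {}"
        by auto
      with ij disj show "i = j"
        by (auto simp: disjoint_family_on_def J_def)
    qed
  qed (fact finS)
  have inner: "mfps_coeff (mfps_sum f (A i)) m = (\<Sum>a\<in>A i \<inter> S. mfps_coeff (f a) m)" if "i \<in> I" for i
    by (rule mfps_coeff_sum_superset) (use finS that in \<open>auto simp: S_def\<close>)
  have "mfps_coeff (mfps_sum (\<lambda>i. mfps_sum f (A i)) I) m = (\<Sum>i\<in>J. mfps_coeff (mfps_sum f (A i)) m)"
  proof (rule mfps_coeff_sum_superset)
    show "{i \<in> I. mfps_coeff (mfps_sum f (A i)) m \<noteq> 0} \<subseteq> J"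
      by (auto simp: J_def inner)
  qed (use finJ in \<open>auto simp: J_def\<close>)
  also have "\<dots> = (\<Sum>i\<in>J. \<Sum>a\<in>A i \<inter> S. mfps_coeff (f a) m)"
    by (rule sum.cong) (auto simp: J_def inner)
  also have "\<dots> = (\<Sum>a\<in>(\<Union>i\<in>J. A i \<inter> S). mfps_coeff (f a) m)"
    by (rule sum.UNION_disjoint[symmetric])
       (use finS finJ disj in \<open>auto simp: J_def disjoint_family_on_def\<close>)
  also have "(\<Union>i\<in>J. A i \<inter> S) = S"
    by (auto simp: J_def S_def)
  also have "(\<Sum>a\<in>S. mfps_coeff (f a) m) = mfps_coeff (mfps_sum f (\<Union>i\<in>I. A i)) m"
    by (simp add: mfps_sum.rep_eq S_def)
  finally show "mfps_coeff (mfps_sum (\<lambda>i. mfps_sum f (A i)) I) m = mfps_coeff (mfps_sum f (\<Union>i\<in>I. A i)) m" .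
qed

section \<open>Products of locally finite sums and of monomials\<close>

text \<open>A monomial has finitely many factorizations, and each involves finitely many indices of
  either family, so every coefficient is a finite sum whose order can be exchanged.\<close>

lemma mfps_sum_product:
  fixes f :: "'i \<Rightarrow> ('a, 'c::comm_ring_1) mfps" and g :: "'j \<Rightarrow> ('a, 'c) mfps"
  assumes "mfps_locally_finite f A" "mfps_locally_finite g B"
  shows "mfps_sum f A * mfps_sum g B = mfps_sum (\<lambda>(i, j). f i * g j) (A \<times> B)"
proof (rule mfps_eqI)
  fix m :: "'a \<Rightarrow>\<^sub>0 nat"
  let ?D = "{(a, b). a + b = m}"
  \<comment> \<open>\<open>S\<close> and \<open>T\<close> collect the indices that matter for any
    factorization of \<open>m\<close>. They do not depend on the factorization chosen, which is what
    permits \<open>sum.swap\<close> below.\<close>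
  define S where "S = (\<Union>(a, b)\<in>?D. {i \<in> A. mfps_coeff (f i) a \<noteq> 0})"
  define T where "T = (\<Union>(a, b)\<in>?D. {j \<in> B. mfps_coeff (g j) b \<noteq> 0})"
  have fin: "finite ?D"
    by (rule finite_antidiagonal)
  have finS: "finite S" and finT: "finite T"
    using fin assms unfolding S_def T_def mfps_locally_finite_def by auto
  have "mfps_coeff (mfps_sum f A * mfps_sum g B) m
      = (\<Sum>(a, b)\<in>?D. mfps_coeff (mfps_sum f A) a * mfps_coeff (mfps_sum g B) b)"
    by (simp add: times_mfps.rep_eq)
  also have "\<dots> = (\<Sum>(a, b)\<in>?D. (\<Sum>i\<in>S. mfps_coeff (f i) a) * (\<Sum>j\<in>T. mfps_coeff (g j) b))"
  proof (intro sum.cong refl, clarify)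
    fix a b assume "m = a + b"
    have "mfps_coeff (mfps_sum f A) a = (\<Sum>i\<in>S. mfps_coeff (f i) a)"
      by (rule mfps_coeff_sum_superset) (use finS in \<open>auto simp: S_def \<open>m = a + b\<close>\<close>)
    moreover have "mfps_coeff (mfps_sum g B) b = (\<Sum>j\<in>T. mfps_coeff (g j) b)"
      by (rule mfps_coeff_sum_superset) (use finT in \<open>auto simp: T_def \<open>m = a + b\<close>\<close>)
    ultimately show "mfps_coeff (mfps_sum f A) a * mfps_coeff (mfps_sum g B) b
        = (\<Sum>i\<in>S. mfps_coeff (f i) a) * (\<Sum>j\<in>T. mfps_coeff (g j) b)"
      by simp
  qed
  also have "\<dots> = (\<Sum>d\<in>?D. \<Sum>p\<in>S \<times> T. mfps_coeff (f (fst p)) (fst d) * mfps_coeff (g (snd p)) (snd d))"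
    by (simp add: sum_product sum.cartesian_product case_prod_unfold)
  also have "\<dots> = (\<Sum>p\<in>S \<times> T. \<Sum>d\<in>?D. mfps_coeff (f (fst p)) (fst d) * mfps_coeff (g (snd p)) (snd d))"
    by (rule sum.swap)
  also have "\<dots> = (\<Sum>p\<in>S \<times> T. mfps_coeff (case p of (i, j) \<Rightarrow> f i * g j) m)"
    by (simp add: times_mfps.rep_eq case_prod_unfold)
  also have "\<dots> = mfps_coeff (mfps_sum (\<lambda>(i, j). f i * g j) (A \<times> B)) m"
  proof (rule mfps_coeff_sum_superset[symmetric])
    \<comment> \<open>A nonzero coefficient of a product forces a nonzero term of the convolution,
      hence a factorization of \<open>m\<close> at which both factors are nonzero.\<close>
    show "{p \<in> A \<times> B. mfps_coeff (case p of (i, j) \<Rightarrow> f i * g j) m \<noteq> 0} \<subseteq> S \<times> T"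
    proof
      fix p assume "p \<in> {p \<in> A \<times> B. mfps_coeff (case p of (i, j) \<Rightarrow> f i * g j) m \<noteq> 0}"
      then obtain i j where p: "p = (i, j)" "i \<in> A" "j \<in> B"
        and nz: "(\<Sum>(a, b)\<in>?D. mfps_coeff (f i) a * mfps_coeff (g j) b) \<noteq> 0"
        by (auto simp: times_mfps.rep_eq)
      from nz obtain d where "d \<in> ?D" "(case d of (a, b) \<Rightarrow> mfps_coeff (f i) a * mfps_coeff (g j) b) \<noteq> 0"
        by (rule sum.not_neutral_contains_not_neutral)
      then obtain a b where "(a, b) \<in> ?D" "mfps_coeff (f i) a \<noteq> 0" "mfps_coeff (g j) b \<noteq> 0"
        by (cases d) (auto dest: mult_not_zero)
      then show "p \<in> S \<times> T"
        using p by (auto simp: S_def T_def)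
    qed
  qed (use finS finT in \<open>auto simp: S_def T_def\<close>)
  finally show "mfps_coeff (mfps_sum f A * mfps_sum g B) m
      = mfps_coeff (mfps_sum (\<lambda>(i, j). f i * g j) (A \<times> B)) m" .
qed

lemma mfps_monom_0: "mfps_monom 0 = (1 :: ('x, 'a::comm_ring_1) mfps)"
  by (rule mfps_eqI) (simp add: mfps_coeff_monom one_mfps.rep_eq)

lemma mfps_monom_mult: "mfps_monom k * mfps_monom l = (mfps_monom (k + l) :: ('x, 'a::comm_ring_1) mfps)"
proof (rule mfps_eqI)
  fix m
  have "mfps_coeff (mfps_monom k * mfps_monom l :: ('x, 'a) mfps) m
      = (\<Sum>d\<in>{(a, b). a + b = m}. if d = (k, l) then 1 else 0)"
    unfolding times_mfps.rep_eq mfps_coeff_monom by (rule sum.cong) (auto split: if_splits)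
  also have "\<dots> = mfps_coeff (mfps_monom (k + l)) m"
    using finite_antidiagonal[of m] by (auto simp: mfps_coeff_monom)
  finally show "mfps_coeff (mfps_monom k * mfps_monom l :: ('x, 'a) mfps) m
      = mfps_coeff (mfps_monom (k + l)) m" .
qed


section \<open>Multicolorings of arbitrary type\<close>

text \<open>The union of \<open>proper_multicolorings H \<alpha>\<close> over all \<alpha>: the
  index set that turns \<open>Y_series\<close> into a single sum of monomials.\<close>

definition multicolorings :: "('a, 'b) pre_digraph \<Rightarrow> ('a \<Rightarrow> nat set) set" where
  "multicolorings H = {\<kappa> \<in> verts H \<rightarrow>\<^sub>E {S. finite S \<and> S \<subseteq> {1..}}.
     \<forall>(w, w') \<in> arcs_ends H. \<kappa> w \<inter> \<kappa> w' = {}}"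

lemma multicolorings_iff:
  "\<kappa> \<in> multicolorings H \<longleftrightarrow> \<kappa> \<in> extensional (verts H)
    \<and> (\<forall>w\<in>verts H. finite (\<kappa> w) \<and> \<kappa> w \<subseteq> {1..})
    \<and> (\<forall>w w'. (w, w') \<in> arcs_ends H \<longrightarrow> \<kappa> w \<inter> \<kappa> w' = {})"
  unfolding multicolorings_def PiE_iff by blast

text \<open>Restricted to the vertices, so that it is one of the extensional maps over which
  \<open>Y_series\<close> sums.\<close>

definition multicoloring_type :: "('a, 'b) pre_digraph \<Rightarrow> ('a \<Rightarrow> nat set) \<Rightarrow> 'a \<Rightarrow> nat" where
  "multicoloring_type H \<kappa> = (\<lambda>w\<in>verts H. card (\<kappa> w))"

abbreviation coloring_monom :: "('a, 'b) pre_digraph \<Rightarrow> ('a \<Rightarrow> nat set) \<Rightarrow> (nat, int) mfps" where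
  "coloring_monom H \<kappa> \<equiv> mfps_monom (multicoloring_exponents H \<kappa>)"

text \<open>For an extensional \<alpha>, agreeing with the cardinalities at every vertex is the same
  as being equal to the type as a function.\<close>

lemma proper_multicolorings_eq:
  assumes "\<alpha> \<in> verts H \<rightarrow>\<^sub>E UNIV"
  shows "proper_multicolorings H \<alpha> = {\<kappa> \<in> multicolorings H. multicoloring_type H \<kappa> = \<alpha>}"
  using assms
  by (auto simp: proper_multicolorings_def multicolorings_def multicoloring_type_def
      fun_eq_iff PiE_iff extensional_def)

lemma multicoloring_type_in: "multicoloring_type H \<kappa> \<in> verts H \<rightarrow>\<^sub>E UNIV"
  by (simp add: multicoloring_type_def)

lemma proper_multicolorings_type:
  "(\<exists>\<alpha>. \<kappa> \<in> proper_multicolorings H \<alpha>) \<longleftrightarrow> \<kappa> \<in> multicolorings H"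
  "\<kappa> \<in> proper_multicolorings H (multicoloring_type H \<kappa>) \<longleftrightarrow> \<kappa> \<in> multicolorings H"
  using proper_multicolorings_eq[OF multicoloring_type_in, of H \<kappa>]
  by (auto simp: proper_multicolorings_def multicolorings_def)

text \<open>Translates the conditions on \<alpha> in the last sum of the theorem into conditions on
  the multicoloring; color sets are finite, so \<open>card\<close> vanishes only on the empty
  one.\<close>

lemma multicoloring_type_ge_1_iff:
  assumes "\<kappa> \<in> multicolorings H" "w \<in> verts H"
  shows "1 \<le> multicoloring_type H \<kappa> w \<longleftrightarrow> \<kappa> w \<noteq> {}"
proof -
  have "finite (\<kappa> w)"
    using assms by (auto simp: multicolorings_def)
  then show ?thesis
    using assms(2) by (simp add: multicoloring_type_def Suc_le_eq card_gt_0_iff)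
qed

lemma coloring_monom_locally_finite:
  assumes "finite (verts H)"
  shows "mfps_locally_finite (coloring_monom H) (multicolorings H)"
  unfolding mfps_locally_finite_def mfps_coeff_monom
proof
  fix m
  show "finite {\<kappa> \<in> multicolorings H. (if m = multicoloring_exponents H \<kappa> then 1 else 0) \<noteq> (0 :: int)}"
    by (rule finite_subset[OF _ finite_multicolorings_exponents[OF assms, of m]])
       (auto simp: proper_multicolorings_type)
qed

text \<open>Each multicoloring has exactly one extensional type, so the inner index sets are
  disjoint and the double sum flattens. It serves both for \<open>Y_series\<close> and for the last
  sum of the theorem.\<close>

lemma mfps_sum_X_series:
  assumes fin: "finite (verts H)" and A: "A \<subseteq> verts H \<rightarrow>\<^sub>E UNIV"
  shows "mfps_sum (X_series H) A
    = mfps_sum (coloring_monom H) {\<kappa> \<in> multicolorings H. multicoloring_type H \<kappa> \<in> A}"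
proof -
  have eq: "(\<Union>\<alpha>\<in>A. proper_multicolorings H \<alpha>) = {\<kappa> \<in> multicolorings H. multicoloring_type H \<kappa> \<in> A}"
    using A by (auto simp: proper_multicolorings_eq subset_iff)
  have "mfps_sum (X_series H) A = mfps_sum (\<lambda>\<alpha>. mfps_sum (coloring_monom H) (proper_multicolorings H \<alpha>)) A"
    by (simp add: X_series_def[abs_def])
  also have "\<dots> = mfps_sum (coloring_monom H) (\<Union>\<alpha>\<in>A. proper_multicolorings H \<alpha>)"
  proof (rule mfps_sum_UN_disjoint)
    show "mfps_locally_finite (coloring_monom H) (\<Union>\<alpha>\<in>A. proper_multicolorings H \<alpha>)"
      unfolding eq by (rule mfps_locally_finite_subset[OF coloring_monom_locally_finite[OF fin]]) auto
    show "disjoint_family_on (proper_multicolorings H) A"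
      using A by (auto simp: disjoint_family_on_def proper_multicolorings_eq subset_iff)
  qed
  finally show ?thesis
    by (simp add: eq)
qed

lemma Y_series_eq_sum_multicolorings:
  assumes "finite (verts H)"
  shows "Y_series H = mfps_sum (coloring_monom H) (multicolorings H)"
  using mfps_sum_X_series[OF assms, of "verts H \<rightarrow>\<^sub>E UNIV"]
  by (simp add: Y_series_def multicoloring_type_in)

lemma lookup_exponents:
  assumes "finite (verts H)" "\<kappa> \<in> multicolorings H"
  shows "Poly_Mapping.lookup (multicoloring_exponents H \<kappa>) i = card {w \<in> verts H. i \<in> \<kappa> w}"
  by (rule lookup_multicoloring_exponents[of _ _ "multicoloring_type H \<kappa>"])
     (use assms in \<open>auto simp: proper_multicolorings_type\<close>)

text \<open>The 1 that is removed is the monomial of the multicoloring with no colors at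
  all.\<close>

lemma Y_series_minus_one:
  assumes wf: "wf_digraph H" and fin: "finite (verts H)"
  shows "Y_series H - 1
    = mfps_sum (coloring_monom H) {\<kappa> \<in> multicolorings H. \<exists>w\<in>verts H. \<kappa> w \<noteq> {}}"
proof -
  let ?z = "\<lambda>w\<in>verts H. {} :: nat set"
  let ?N = "{\<kappa> \<in> multicolorings H. \<exists>w\<in>verts H. \<kappa> w \<noteq> {}}"
  \<comment> \<open>Well-formedness puts the ends of arcs among the vertices, where
    \<open>?z\<close> is empty rather than \<open>undefined\<close>.\<close>
  have z: "?z \<in> multicolorings H"
    by (auto simp: multicolorings_iff dest: wf_digraph.adj_in_verts[OF wf])
  have split: "multicolorings H = {?z} \<union> ?N"
  proof (intro equalityI subsetI)
    fix \<kappa> assume \<kappa>: "\<kappa> \<in> multicolorings H"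
    show "\<kappa> \<in> {?z} \<union> ?N"
    proof (cases "\<exists>w\<in>verts H. \<kappa> w \<noteq> {}")
      case False
      then have "\<kappa> = ?z"
        using \<kappa> by (auto simp: multicolorings_def fun_eq_iff PiE_iff extensional_def)
      then show ?thesis by simp
    qed (use \<kappa> in auto)
  qed (use z in auto)
  have "multicoloring_exponents H ?z = 0"
    by (rule poly_mapping_eqI) (auto simp: lookup_exponents[OF fin z])
  moreover have "mfps_sum (coloring_monom H) (multicolorings H)
      = mfps_sum (coloring_monom H) {?z} + mfps_sum (coloring_monom H) ?N"
    by (subst split, rule mfps_sum_union_disjoint)
       (use z in \<open>auto intro!: mfps_locally_finite_subset[OF coloring_monom_locally_finite[OF fin]]\<close>)
  ultimately show ?thesis
    by (simp add: Y_series_eq_sum_multicolorings[OF fin] mfps_sum_finite mfps_monom_0)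
qed


section \<open>Clan graphs\<close>

lemma verts_clan_graph: "verts (clan_graph G v n) = Inl ` (verts G - {v}) \<union> Inr ` {1..n}"
  by (simp add: clan_graph_def)

lemma arcs_ends_clan_graph: "arcs_ends (clan_graph G v n) =
    {(Inl a, Inl b) | a b. (a, b) \<in> arcs_ends G \<and> a \<noteq> v \<and> b \<noteq> v}
  \<union> {(Inl a, Inr i) | a i. (a, v) \<in> arcs_ends G \<and> i \<in> {1..n}}
  \<union> {(Inr i, Inl b) | i b. (v, b) \<in> arcs_ends G \<and> i \<in> {1..n}}
  \<union> {(Inr i, Inr j) | i j. i \<in> {1..n} \<and> j \<in> {1..n} \<and> i \<noteq> j}"
  by (simp add: clan_graph_def arcs_ends_def arc_to_ends_def)

text \<open>Sorts vertices and arcs by original vertex or clone, so that later steps deal with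
  conditions on \<open>G\<close> instead of cases of the sum type.\<close>

lemma multicolorings_clan_graph_iff:
  "\<kappa> \<in> multicolorings (clan_graph G v n) \<longleftrightarrow> \<kappa> \<in> extensional (verts (clan_graph G v n))
    \<and> (\<forall>a\<in>verts G - {v}. finite (\<kappa> (Inl a)) \<and> \<kappa> (Inl a) \<subseteq> {1..})
    \<and> (\<forall>i\<in>{1..n}. finite (\<kappa> (Inr i)) \<and> \<kappa> (Inr i) \<subseteq> {1..})
    \<and> (\<forall>a b. (a, b) \<in> arcs_ends G \<and> a \<noteq> v \<and> b \<noteq> v \<longrightarrow> \<kappa> (Inl a) \<inter> \<kappa> (Inl b) = {})
    \<and> (\<forall>a. (a, v) \<in> arcs_ends G \<or> (v, a) \<in> arcs_ends G
          \<longrightarrow> (\<forall>i\<in>{1..n}. \<kappa> (Inl a) \<inter> \<kappa> (Inr i) = {}))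
    \<and> (\<forall>i\<in>{1..n}. \<forall>j\<in>{1..n}. i \<noteq> j \<longrightarrow> \<kappa> (Inr i) \<inter> \<kappa> (Inr j) = {})"
proof -
  have verts: "(\<forall>x\<in>verts (clan_graph G v n). P x)
      \<longleftrightarrow> (\<forall>a\<in>verts G - {v}. P (Inl a)) \<and> (\<forall>i\<in>{1..n}. P (Inr i))" for P
    by (auto simp: verts_clan_graph)
  have arcs: "(\<forall>x y. (x, y) \<in> arcs_ends (clan_graph G v n) \<longrightarrow> P x y)
      \<longleftrightarrow> (\<forall>a b. (a, b) \<in> arcs_ends G \<and> a \<noteq> v \<and> b \<noteq> v \<longrightarrow> P (Inl a) (Inl b))
        \<and> (\<forall>a. (a, v) \<in> arcs_ends G \<longrightarrow> (\<forall>i\<in>{1..n}. P (Inl a) (Inr i)))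
        \<and> (\<forall>b. (v, b) \<in> arcs_ends G \<longrightarrow> (\<forall>i\<in>{1..n}. P (Inr i) (Inl b)))
        \<and> (\<forall>i\<in>{1..n}. \<forall>j\<in>{1..n}. i \<noteq> j \<longrightarrow> P (Inr i) (Inr j))" for P
  proof -
    \<comment> \<open>General \<open>f\<close> and \<open>g\<close> let this one equivalence match
      all four families of arcs.\<close>
    have pairs: "(\<forall>x y. (x, y) \<in> {(f a b, g a b) | a b. Q a b} \<longrightarrow> P x y) \<longleftrightarrow> (\<forall>a b. Q a b \<longrightarrow> P (f a b) (g a b))"
      for f :: "'c \<Rightarrow> 'd \<Rightarrow> 'a + nat" and g Q
      by blast
    show ?thesis
      unfolding arcs_ends_clan_graph by (simp only: Un_iff imp_disjL all_conj_distrib pairs) (intro iffI conjI; elim conjE; blast)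
  qed
  \<comment> \<open>Both sides are normalized: the disjunction on the right is split, and
    intersections from arcs leaving a clone are commuted so that \<open>\<kappa> (Inl _)\<close>
    stands first.\<close>
  show ?thesis
    unfolding multicolorings_iff verts arcs imp_disjL all_conj_distrib Int_commute[of "\<kappa> (Inr _)" "\<kappa> (Inl _)"]
    by (simp only: conj_assoc)
qed

section \<open>Complete graphs, vertex deletion and the neighbor of a leaf\<close>

lemma verts_complete_graph: "verts (complete_graph n) = {1..n}"
  by (simp add: complete_graph_def)

lemma arcs_ends_complete_graph:
  "arcs_ends (complete_graph n) = {(i, j). i \<in> {1..n} \<and> j \<in> {1..n} \<and> i \<noteq> j}"
  by (simp add: complete_graph_def arcs_ends_def arc_to_ends_def)

lemma wf_complete_graph: "wf_digraph (complete_graph n)"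
  by unfold_locales (auto simp: complete_graph_def)

lemma verts_delete_verts: "verts (delete_verts G S) = verts G - S"
  by (simp add: delete_verts_def)

text \<open>Arcs of a well-formed digraph end in its vertex set, so lying in
  \<open>verts G - S\<close> reduces to avoiding \<open>S\<close>.\<close>

lemma arcs_ends_delete_verts:
  assumes "wf_digraph G"
  shows "arcs_ends (delete_verts G S) = {(a, b) \<in> arcs_ends G. a \<notin> S \<and> b \<notin> S}"
proof -
  interpret wf_digraph G by fact
  show ?thesis
    by (auto simp: delete_verts_def arcs_ends_def arc_to_ends_def image_iff)
qed

text \<open>A leaf has a single outgoing arc, and any neighbor is the head of that arc.\<close>

lemma leaf_neighbor_unique:
  assumes "graph G" "leaf_vertex G v" "(v, a) \<in> arcs_ends G" "(v, b) \<in> arcs_ends G"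
  shows "a = b"
proof -
  obtain e where e: "out_arcs G v = {e}"
    using assms(2) by (auto simp: leaf_vertex_def out_degree_def card_1_singleton_iff)
  have "w = head G e" if "(v, w) \<in> arcs_ends G" for w
    using that e by (auto simp: arcs_ends_def arc_to_ends_def out_arcs_def set_eq_iff)
  with assms show ?thesis by blast
qed

section \<open>Multicolorings with no color on the clones, or with none on the neighbor of the
  leaf\<close>

text \<open>Empty clones satisfy every disjointness condition, leaving only those along arcs of
  \<open>G\<close> that avoid \<open>v\<close>.\<close>

lemma clan_Y_series_uncolored_clones:
  assumes G: "graph G"
  shows "mfps_sum (coloring_monom (clan_graph G v n))
      {\<kappa> \<in> multicolorings (clan_graph G v n). \<forall>i\<in>{1..n}. \<kappa> (Inr i) = {}}
    = Y_series (delete_verts G {v})" (is "mfps_sum _ ?A = _")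
proof -
  interpret graph G by fact
  let ?C = "clan_graph G v n" and ?D = "delete_verts G {v}"
  have fin: "finite (verts ?D)" "finite (verts ?C)"
    by (auto simp: verts_delete_verts verts_clan_graph)
  note arcs = arcs_ends_delete_verts[OF wf_digraph_axioms]
  note vs = verts_clan_graph verts_delete_verts
  have adj: "a \<in> verts G" "b \<in> verts G" "a \<noteq> b" if "(a, b) \<in> arcs_ends G" for a b
    using that adj_in_verts adj_not_same by blast+
  \<comment> \<open>The inverse bijections: \<open>ext\<close> puts the empty set on every clone,
    \<open>res\<close> forgets the clones.\<close>
  define ext where "ext \<kappa> = (\<lambda>x\<in>verts ?C. case x of Inl a \<Rightarrow> \<kappa> a | Inr i \<Rightarrow> {})" for \<kappa> :: "'a \<Rightarrow> nat set"
  define res where "res \<kappa> = (\<lambda>a\<in>verts ?D. \<kappa> (Inl a))" for \<kappa> :: "'a + nat \<Rightarrow> nat set"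
  have ext_in: "ext \<kappa> \<in> ?A" if "\<kappa> \<in> multicolorings ?D" for \<kappa>
    using that unfolding mem_Collect_eq multicolorings_clan_graph_iff
    unfolding multicolorings_iff by (auto simp: ext_def arcs vs dest: adj)
  show ?thesis
    unfolding Y_series_eq_sum_multicolorings[OF fin(1)]
  proof (rule mfps_sum_reindex_bij_witness[of _ ext res])
    show "ext (res \<kappa>) = \<kappa>" if "\<kappa> \<in> ?A" for \<kappa>
      using that by (auto simp: multicolorings_def ext_def res_def vs PiE_iff extensional_def
          fun_eq_iff split: sum.split)
    show "res \<kappa> \<in> multicolorings ?D" if "\<kappa> \<in> ?A" for \<kappa>
      using that unfolding mem_Collect_eq multicolorings_clan_graph_iff
      unfolding multicolorings_iff by (auto simp: res_def arcs vs dest: adj)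
    show "res (ext \<kappa>) = \<kappa>" if "\<kappa> \<in> multicolorings ?D" for \<kappa>
      using that by (auto simp: multicolorings_def ext_def res_def vs PiE_iff extensional_def fun_eq_iff)
    show "ext \<kappa> \<in> ?A" if "\<kappa> \<in> multicolorings ?D" for \<kappa>
      using that by (rule ext_in)
    show "coloring_monom ?C (ext \<kappa>) = coloring_monom ?D \<kappa>" if \<kappa>: "\<kappa> \<in> multicolorings ?D" for \<kappa>
    proof -
      have "multicoloring_exponents ?C (ext \<kappa>) = multicoloring_exponents ?D \<kappa>"
      proof (rule poly_mapping_eqI)
        fix k
        \<comment> \<open>Empty clones lie in no color class, so each class is the image of a class
          in \<open>?D\<close>.\<close>
        have "{x \<in> verts ?C. k \<in> ext \<kappa> x} = Inl ` {a \<in> verts ?D. k \<in> \<kappa> a}"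
          by (auto simp: vs ext_def)
        then show "Poly_Mapping.lookup (multicoloring_exponents ?C (ext \<kappa>)) k
            = Poly_Mapping.lookup (multicoloring_exponents ?D \<kappa>) k"
          using ext_in[OF \<kappa>] \<kappa> fin by (simp add: lookup_exponents card_image)
      qed
      then show ?thesis by simp
    qed
  qed
qed

text \<open>All arcs between the clones and the rest meet \<open>Inl u\<close>, which is uncolored.
  The coloring thus splits into two independent parts whose exponents add, and the sum becomes a
  product.\<close>

lemma clan_Y_series_uncolored_neighbor:
  assumes G: "graph G" and leaf: "leaf_vertex G v" and uv: "(u, v) \<in> arcs_ends G"
  shows "mfps_sum (coloring_monom (clan_graph G v n))
      {\<kappa> \<in> multicolorings (clan_graph G v n). \<kappa> (Inl u) = {} \<and> (\<exists>i\<in>{1..n}. \<kappa> (Inr i) \<noteq> {})}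
    = (Y_series (complete_graph n) - 1) * Y_series (delete_verts G {u, v})" (is "mfps_sum _ ?A = _")
proof -
  interpret graph G by fact
  let ?C = "clan_graph G v n" and ?D = "delete_verts G {u, v}" and ?K = "complete_graph n"
  let ?N = "{\<kappa> \<in> multicolorings ?K. \<exists>w\<in>verts ?K. \<kappa> w \<noteq> {}}"
  have fin: "finite (verts ?D)" "finite (verts ?C)" "finite (verts ?K)"
    by (auto simp: verts_delete_verts verts_clan_graph verts_complete_graph)
  have arc_sym: "(b, a) \<in> arcs_ends G" if "(a, b) \<in> arcs_ends G" for a b
    using that sym_arcs by (auto simp: symmetric_def dest: symD)
  have nbr: "(v, a) \<in> arcs_ends G \<longleftrightarrow> a = u" "(a, v) \<in> arcs_ends G \<longleftrightarrow> a = u" for a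
    using leaf_neighbor_unique[OF G leaf] arc_sym uv by blast+
  have u: "u \<in> verts G" "u \<noteq> v"
    using uv adj_in_verts adj_not_same by blast+
  have adj: "a \<in> verts G" "b \<in> verts G" "a \<noteq> b" if "(a, b) \<in> arcs_ends G" for a b
    using that adj_in_verts adj_not_same by blast+
  note arcs = arcs_ends_delete_verts[OF wf_digraph_axioms] arcs_ends_complete_graph
  note vs = verts_clan_graph verts_delete_verts verts_complete_graph
  \<comment> \<open>\<open>ext\<close> glues a coloring of the clones to one of \<open>?D\<close>,
    with the empty set on \<open>u\<close>; \<open>res\<close> takes the two parts back.\<close>
  define ext :: "(nat \<Rightarrow> nat set) \<times> ('a \<Rightarrow> nat set) \<Rightarrow> 'a + nat \<Rightarrow> nat set"
    where "ext = (\<lambda>(\<nu>, \<kappa>). \<lambda>x\<in>verts ?C. case x of Inl a \<Rightarrow> if a = u then {} else \<kappa> a | Inr i \<Rightarrow> \<nu> i)"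
  define res where "res \<kappa> = (\<lambda>i\<in>verts ?K. \<kappa> (Inr i), \<lambda>a\<in>verts ?D. \<kappa> (Inl a))"
    for \<kappa> :: "'a + nat \<Rightarrow> nat set"
  have ext_in: "ext (\<nu>, \<kappa>) \<in> ?A" if "\<nu> \<in> ?N" "\<kappa> \<in> multicolorings ?D" for \<nu> \<kappa>
  proof -
    have \<nu>: "finite (\<nu> i)" "\<nu> i \<subseteq> {1..}" if "i \<in> {1..n}" for i
      using \<open>\<nu> \<in> ?N\<close> that by (auto simp: multicolorings_iff vs)
    have \<nu>_disj: "\<nu> i \<inter> \<nu> j = {}" if "i \<in> {1..n}" "j \<in> {1..n}" "i \<noteq> j" for i j
      using \<open>\<nu> \<in> ?N\<close> that by (auto simp: multicolorings_iff arcs)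
    have \<kappa>: "finite (\<kappa> a)" "\<kappa> a \<subseteq> {1..}" if "a \<in> verts G" "a \<noteq> u" "a \<noteq> v" for a
      using \<open>\<kappa> \<in> multicolorings ?D\<close> that by (auto simp: multicolorings_iff vs)
    have \<kappa>_disj: "\<kappa> a \<inter> \<kappa> b = {}"
      if "(a, b) \<in> arcs_ends G" "a \<noteq> u" "a \<noteq> v" "b \<noteq> u" "b \<noteq> v" for a b
      using \<open>\<kappa> \<in> multicolorings ?D\<close> that by (simp add: multicolorings_iff arcs)
    have ext_simps: "ext (\<nu>, \<kappa>) (Inl a) = (if a = u then {} else \<kappa> a)" if "a \<in> verts G" "a \<noteq> v" for a
      using that by (simp add: ext_def vs)
    have ext_simps': "ext (\<nu>, \<kappa>) (Inr i) = \<nu> i" if "i \<in> {1..n}" for i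
      using that by (auto simp: ext_def vs)
    have "ext (\<nu>, \<kappa>) \<in> extensional (verts ?C)"
      by (simp add: ext_def)
    moreover have "ext (\<nu>, \<kappa>) (Inl a) \<inter> ext (\<nu>, \<kappa>) (Inl b) = {}"
      if "(a, b) \<in> arcs_ends G" "a \<noteq> v" "b \<noteq> v" for a b
      using \<kappa>_disj[OF that(1)] that adj[OF that(1)] by (simp add: ext_simps)
    ultimately have "ext (\<nu>, \<kappa>) \<in> multicolorings ?C"
      \<comment> \<open>By \<open>nbr\<close> the mixed conditions concern only \<open>u\<close>,
        where \<open>ext\<close> is empty.\<close>
      unfolding multicolorings_clan_graph_iff
      using \<nu> \<nu>_disj \<kappa> u by (simp add: ext_simps ext_simps' nbr)
    moreover have "\<exists>i\<in>{1..n}. \<nu> i \<noteq> {}"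
      using \<open>\<nu> \<in> ?N\<close> by (auto simp: vs)
    ultimately show ?thesis
      using u ext_simps ext_simps' by simp
  qed
  have "mfps_sum (coloring_monom ?C) ?A
      = mfps_sum (\<lambda>(\<nu>, \<kappa>). coloring_monom ?K \<nu> * coloring_monom ?D \<kappa>) (?N \<times> multicolorings ?D)"
  proof (rule mfps_sum_reindex_bij_witness[of _ ext res])
    show "ext (res \<kappa>) = \<kappa>" if "\<kappa> \<in> ?A" for \<kappa>
    proof
      fix x
      \<comment> \<open>\<open>res\<close> drops the value at \<open>Inl u\<close>; it is recovered
        because membership in \<open>?A\<close> makes it empty.\<close>
      have *: "\<kappa> \<in> extensional (verts ?C)" "\<kappa> (Inl u) = {}"
        using that by (auto simp: multicolorings_iff)
      show "ext (res \<kappa>) x = \<kappa> x"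
      proof (cases "x \<in> verts ?C")
        case True
        then show ?thesis
          using * by (cases x) (auto simp: ext_def res_def vs)
      qed (use * in \<open>simp add: ext_def res_def extensional_def\<close>)
    qed
    show "res \<kappa> \<in> ?N \<times> multicolorings ?D" if "\<kappa> \<in> ?A" for \<kappa>
    proof -
      have ok: "finite (\<kappa> (Inl a)) \<and> \<kappa> (Inl a) \<subseteq> {1..}" if "a \<in> verts G - {v}" for a
        using \<open>\<kappa> \<in> ?A\<close> that unfolding mem_Collect_eq multicolorings_clan_graph_iff by blast
      have disj: "\<kappa> (Inl a) \<inter> \<kappa> (Inl b) = {}" if "(a, b) \<in> arcs_ends G" "a \<noteq> v" "b \<noteq> v" for a b
        using \<open>\<kappa> \<in> ?A\<close> that unfolding mem_Collect_eq multicolorings_clan_graph_iff by blast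
      have ok': "finite (\<kappa> (Inr i)) \<and> \<kappa> (Inr i) \<subseteq> {1..}" if "i \<in> {1..n}" for i
        using \<open>\<kappa> \<in> ?A\<close> that unfolding mem_Collect_eq multicolorings_clan_graph_iff by blast
      have disj': "\<kappa> (Inr i) \<inter> \<kappa> (Inr j) = {}" if "i \<in> {1..n}" "j \<in> {1..n}" "i \<noteq> j" for i j
        using \<open>\<kappa> \<in> ?A\<close> that unfolding mem_Collect_eq multicolorings_clan_graph_iff by blast
      have "(\<lambda>i\<in>verts ?K. \<kappa> (Inr i)) \<in> multicolorings ?K"
        using ok' disj' unfolding multicolorings_iff arcs vs by simp
      moreover have "(\<lambda>a\<in>verts ?D. \<kappa> (Inl a)) \<in> multicolorings ?D"
        unfolding multicolorings_iff
      proof (intro conjI ballI allI impI)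
        fix a b assume "(a, b) \<in> arcs_ends ?D"
        then have "(a, b) \<in> arcs_ends G" "a \<notin> {u, v}" "b \<notin> {u, v}"
          by (auto simp: arcs)
        with disj[of a b] adj[of a b] show "(\<lambda>a\<in>verts ?D. \<kappa> (Inl a)) a \<inter> (\<lambda>a\<in>verts ?D. \<kappa> (Inl a)) b = {}"
          by (simp add: vs)
      qed (use ok in \<open>auto simp: vs\<close>)
      moreover have "\<exists>i\<in>{1..n}. \<kappa> (Inr i) \<noteq> {}"
        using that by blast
      ultimately show ?thesis
        by (simp add: res_def vs)
    qed
    show "res (ext p) = p" if "p \<in> ?N \<times> multicolorings ?D" for p
    proof -
      obtain \<nu> \<kappa> where p: "p = (\<nu>, \<kappa>)" "\<nu> \<in> extensional (verts ?K)" "\<kappa> \<in> extensional (verts ?D)"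
        using \<open>p \<in> ?N \<times> multicolorings ?D\<close> by (auto simp: multicolorings_iff)
      have "(\<lambda>i\<in>verts ?K. ext p (Inr i)) = \<nu>"
        using p by (auto simp: ext_def vs intro!: extensionalityI[of _ "{1..n}"])
      moreover have "(\<lambda>a\<in>verts ?D. ext p (Inl a)) = \<kappa>"
        using p by (auto simp: ext_def vs intro!: extensionalityI[of _ "verts G - {u, v}"])
      ultimately show ?thesis
        by (simp add: res_def p(1))
    qed
    show "ext p \<in> ?A" if "p \<in> ?N \<times> multicolorings ?D" for p
      using that ext_in by (cases p) blast
    show "coloring_monom ?C (ext p) = (case p of (\<nu>, \<kappa>) \<Rightarrow> coloring_monom ?K \<nu> * coloring_monom ?D \<kappa>)"
      if "p \<in> ?N \<times> multicolorings ?D" for p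
    proof -
      obtain \<nu> \<kappa> where p: "p = (\<nu>, \<kappa>)" "\<nu> \<in> ?N" "\<kappa> \<in> multicolorings ?D"
        using \<open>p \<in> ?N \<times> multicolorings ?D\<close> by blast
      have "multicoloring_exponents ?C (ext (\<nu>, \<kappa>)) = multicoloring_exponents ?K \<nu> + multicoloring_exponents ?D \<kappa>"
      proof (rule poly_mapping_eqI)
        fix k
        \<comment> \<open>The color class of \<open>k\<close> is a disjoint union of clones and
          vertices of \<open>?D\<close>, since \<open>u\<close> carries no color; hence the
          exponents add.\<close>
        have "{x \<in> verts ?C. k \<in> ext (\<nu>, \<kappa>) x}
            = Inr ` {i \<in> verts ?K. k \<in> \<nu> i} \<union> Inl ` {a \<in> verts ?D. k \<in> \<kappa> a}"
          by (auto simp: vs ext_def split: if_splits)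
        then have "card {x \<in> verts ?C. k \<in> ext (\<nu>, \<kappa>) x}
            = card {i \<in> verts ?K. k \<in> \<nu> i} + card {a \<in> verts ?D. k \<in> \<kappa> a}"
          using fin
          by (simp, subst card_Un_disjoint) (auto simp: card_image)
        then show "Poly_Mapping.lookup (multicoloring_exponents ?C (ext (\<nu>, \<kappa>))) k
            = Poly_Mapping.lookup (multicoloring_exponents ?K \<nu> + multicoloring_exponents ?D \<kappa>) k"
          using ext_in[OF p(2,3)] p(2,3) fin by (simp add: lookup_exponents lookup_add)
      qed
      then show ?thesis
        by (simp add: p(1) mfps_monom_mult)
    qed
  qed
  also have "\<dots> = mfps_sum (coloring_monom ?K) ?N * mfps_sum (coloring_monom ?D) (multicolorings ?D)"
    by (intro mfps_sum_product[symmetric] coloring_monom_locally_finite fin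
        mfps_locally_finite_subset[OF coloring_monom_locally_finite]) auto
  finally show ?thesis
    by (simp only: Y_series_minus_one[OF wf_complete_graph fin(3)] Y_series_eq_sum_multicolorings[OF fin(1)])
qed

section \<open>Decomposition by the colors on the neighbor and on the clones\<close>

theorem proposition3p4:
  fixes G :: "('a, 'b) pre_digraph" and u v :: 'a and n :: nat
  assumes "graph G"
    and "leaf_vertex G v"
    and "(u, v) \<in> arcs_ends G"
    and "n \<ge> 2"
  shows "Y_series (clan_graph G v n) =
    Y_series (delete_verts G {v})
    + (Y_series (complete_graph n) - 1) * Y_series (delete_verts G {u, v})
    + mfps_sum (X_series (clan_graph G v n))
        {\<alpha> \<in> verts (clan_graph G v n) \<rightarrow>\<^sub>E UNIV. \<alpha> (Inl u) \<ge> 1 \<and> (\<exists>i\<in>{1..n}. \<alpha> (Inr i) \<ge> 1)}"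
proof -
  interpret graph G by fact
  let ?C = "clan_graph G v n"
  let ?A = "{\<kappa> \<in> multicolorings ?C. \<forall>i\<in>{1..n}. \<kappa> (Inr i) = {}}"
  let ?B = "{\<kappa> \<in> multicolorings ?C. \<kappa> (Inl u) = {} \<and> (\<exists>i\<in>{1..n}. \<kappa> (Inr i) \<noteq> {})}"
  let ?E = "{\<kappa> \<in> multicolorings ?C. \<kappa> (Inl u) \<noteq> {} \<and> (\<exists>i\<in>{1..n}. \<kappa> (Inr i) \<noteq> {})}"
  let ?T = "{\<alpha> \<in> verts ?C \<rightarrow>\<^sub>E UNIV. \<alpha> (Inl u) \<ge> 1 \<and> (\<exists>i\<in>{1..n}. \<alpha> (Inr i) \<ge> 1)}"
  have fin: "finite (verts ?C)"
    by (simp add: verts_clan_graph)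
  have "u \<in> verts G" "u \<noteq> v"
    using assms(3) adj_in_verts adj_not_same by blast+
  then have verts: "Inl u \<in> verts ?C" "i \<in> {1..n} \<Longrightarrow> Inr i \<in> verts ?C" for i
    by (auto simp: verts_clan_graph)
  have "{\<kappa> \<in> multicolorings ?C. multicoloring_type ?C \<kappa> \<in> ?T} = ?E"
  proof (rule Collect_cong, rule conj_cong[OF refl])
    fix \<kappa> assume \<kappa>: "\<kappa> \<in> multicolorings ?C"
    show "multicoloring_type ?C \<kappa> \<in> ?T \<longleftrightarrow> \<kappa> (Inl u) \<noteq> {} \<and> (\<exists>i\<in>{1..n}. \<kappa> (Inr i) \<noteq> {})"
      \<comment> \<open>\<open>bex_cong\<close> keeps the range of \<open>i\<close> at hand while
        the body is rewritten; \<open>verts\<close> needs it to see that \<open>Inr i\<close> is a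
        vertex.\<close>
      unfolding mem_Collect_eq
      by (simp only: multicoloring_type_in multicoloring_type_ge_1_iff[OF \<kappa>] verts cong: bex_cong) simp
  qed
  then have E: "mfps_sum (X_series ?C) ?T = mfps_sum (coloring_monom ?C) ?E"
    using mfps_sum_X_series[OF fin, of ?T] by (simp only: Collect_restrict)
  have lf: "mfps_locally_finite (coloring_monom ?C) S" if "S \<subseteq> multicolorings ?C" for S
    using coloring_monom_locally_finite[OF fin] that by (rule mfps_locally_finite_subset)
  \<comment> \<open>\<open>?A\<close>, \<open>?B\<close> and \<open>?E\<close> partition the
    multicolorings: first by whether some clone is colored, then by whether \<open>Inl u\<close>
    is.\<close>
  have "Y_series ?C = mfps_sum (coloring_monom ?C) ((?A \<union> ?B) \<union> ?E)"
    unfolding Y_series_eq_sum_multicolorings[OF fin] by (rule arg_cong[of _ _ "mfps_sum _"]) blast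
  also have "\<dots> = mfps_sum (coloring_monom ?C) (?A \<union> ?B) + mfps_sum (coloring_monom ?C) ?E"
    by (intro mfps_sum_union_disjoint lf; blast)
  also have "mfps_sum (coloring_monom ?C) (?A \<union> ?B)
      = mfps_sum (coloring_monom ?C) ?A + mfps_sum (coloring_monom ?C) ?B"
    by (intro mfps_sum_union_disjoint lf; blast)
  finally show ?thesis
    by (simp only: E clan_Y_series_uncolored_clones[OF assms(1)]
        clan_Y_series_uncolored_neighbor[OF assms(1-3)])
qed

end
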